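(* Let $n\ge 4$, let $\rho:\{1,\dots,n\}\to\{1,2,3\}$ be surjective, and let $P$ be a one nested bracketing of $n$ letters whose last step is a right step. Consider the identity in three variables $x_1,x_2,x_3$ $$x_{\rho(1)}\bigl(x_{\rho(2)}(\cdots(x_{\rho(n-1)}x_{\rho(n)})\cdots)\bigr)=P(x_{\rho(1)},\dots,x_{\rho(n)}).\qquad( * )$$ Let $Q$ be a loop satisfying $( * )$, let $Z$ be a commutative group, and let an action $Z\times Q\to Z$ be given. Then the set of equivalence classes of extensions $L$ of $Q$ by $Z$ with the given action such that the loop $L$ satisfies $( * )$ is in one-to-one correspondence with the cohomology group $$H^2(Q,Z;\delta)=\ker\bigl(\delta_\rho:C^2(Q,Z)\to C^3(Q,Z)\bigr)/\delta\bigl(C^1(Q,Z)\bigr).$$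
   Context: A loop is a set with a binary operation having a two-sided neutral element $e$ and such that all left and right translations are bijective. Action: $Z$ is a commutative group written additively; an action $Z\times Q\to Z$, $(z,a)\mapsto za$, is an action by group automorphisms of $Z$ with $ze=z$ and $(za)b=z(ab)$ for all $a,b\in Q$. Extension of $Q$ by $Z$ with the given action: a loop $L$ with an injective homomorphism $Z\to L$ (we identify $Z$ with its image) and a surjective loop homomorphism $j:L\to Q$ with $\{\ell\in L: j(\ell)=e\}=Z$, such that the elements of $Z$ associate with all elements of $L$ (that is, $(uv)w=u(vw)$ whenever at least one of $u,v,w\in L$ lies in $Z$), and $z\,\ell=\ell\,(z\cdot j(\ell))$ for all $z\in Z,\ \ell\in L$, where $z\cdot j(\ell)\in Z$ denotes the action. Two extensions $L,M$ are equivalent if there is a loop homomorphism $\varphi:M\to L$ that restricts to the identity on $Z$ and commutes with the projections to $Q$. Cochains: $C^1(Q,Z)$ is the group of functions $h:Q\to Z$ with $h(e)=0$; $C^2(Q,Z)$ is the group of functions $f:Q\times Q\to Z$ with $f(x,e)=f(e,x)=0$ for all $x$; $C^3(Q,Z)$ is the group of functions $Q^3\to Z$. The differential $\delta:C^1(Q,Z)\to C^2(Q,Z)$ is $(\delta h)(x,y)=h(y)-h(xy)+h(x)y$. One nested bracketing: a bracketed product $P(a_1,\dots,a_n)$ of $n$ letters in this order, formed by starting with an adjacent pair $P_1=a_sa_{s+1}$, $[l_1,r_1]=[s,s+1]$, and then successively multiplying the current product by the adjacent letter on one side: either a left step $P_{k+1}=a_{l_k-1}P_k$, $[l_{k+1},r_{k+1}]=[l_k-1,r_k]$,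 or a right step $P_{k+1}=P_k\,a_{r_k+1}$, $[l_{k+1},r_{k+1}]=[l_k,r_k+1]$, until $[l_{n-1},r_{n-1}]=[1,n]$; $P=P_{n-1}$. Factor sum: for $f\in C^2(Q,Z)$ and a one nested bracketing $P$, set $F_1=f(a_s,a_{s+1})$; $F_{k+1}=f(a_{l_k-1},P_k)+F_k$ for a left step; $F_{k+1}=f(P_k,a_{r_k+1})+F_k\cdot a_{r_k+1}$ for a right step (with $\cdot$ the action); $F_P(a_1,\dots,a_n)=F_{n-1}$. Differential associated to the identity: for $(a_1,\dots,a_n)\in Q^n$, $$(\delta f)(a_1,\dots,a_n)=F_P(a_1,\dots,a_n)-\sum_{i=1}^{n-1}f\bigl(a_i,\ a_{i+1}(a_{i+2}(\cdots(a_{n-1}a_n)\cdots))\bigr),$$ and with repetitions $(\delta_\rho f)(x_1,x_2,x_3)=(\delta f)(x_{\rho(1)},\dots,x_{\rho(n)})$. *)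

theory Defs
  imports "HOL-Algebra.Algebra" "HOL-Library.Equipollence"
begin

text \<open>
  Loops are carried by the \<^typ>\<open>'a monoid\<close> record, without associativity, so that
  \<^const>\<open>hom\<close>, \<^const>\<open>mon\<close>, \<^const>\<open>epi\<close> and \<^const>\<open>kernel\<close> apply to them. A multiplication
  preserving map between loops preserves the neutral element.
\<close>

locale loop =
  fixes Q :: "('a, 'b) monoid_scheme" (structure)
  assumes m_closed: "\<lbrakk>a \<in> carrier Q; b \<in> carrier Q\<rbrakk> \<Longrightarrow> a \<otimes> b \<in> carrier Q"
    and one_closed: "\<one> \<in> carrier Q"
    and l_one: "a \<in> carrier Q \<Longrightarrow> \<one> \<otimes> a = a"
    and r_one: "a \<in> carrier Q \<Longrightarrow> a \<otimes> \<one> = a"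
    and l_translation: "a \<in> carrier Q \<Longrightarrow> bij_betw (\<lambda>b. a \<otimes> b) (carrier Q) (carrier Q)"
    and r_translation: "a \<in> carrier Q \<Longrightarrow> bij_betw (\<lambda>b. b \<otimes> a) (carrier Q) (carrier Q)"

text \<open>
  The commutative group \<open>Z\<close> is additive on paper; here it is a \<^const>\<open>comm_group\<close>, so its
  sum, zero and negation appear as \<open>\<otimes>\<close>, \<open>\<one>\<close> and \<open>inv\<close>.
\<close>

definition is_action ::
    "('z, 'm) monoid_scheme \<Rightarrow> ('q, 'k) monoid_scheme \<Rightarrow> ('z \<Rightarrow> 'q \<Rightarrow> 'z) \<Rightarrow> bool" where
  "is_action Z Q act \<longleftrightarrow>
     (\<forall>a\<in>carrier Q. (\<lambda>z. act z a) \<in> iso Z Z) \<and>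
     (\<forall>z\<in>carrier Z. act z \<one>\<^bsub>Q\<^esub> = z) \<and>
     (\<forall>z\<in>carrier Z. \<forall>a\<in>carrier Q. \<forall>b\<in>carrier Q. act (act z a) b = act z (a \<otimes>\<^bsub>Q\<^esub> b))"

text \<open>An extension is a triple of a loop \<open>L\<close>, an embedding \<open>i : Z \<rightarrow> L\<close> and a projection \<open>j : L \<rightarrow> Q\<close>.\<close>

type_synonym ('z, 'q, 'l) ext = "'l monoid \<times> ('z \<Rightarrow> 'l) \<times> ('l \<Rightarrow> 'q)"

fun is_extension ::
    "('z, 'm) monoid_scheme \<Rightarrow> ('q, 'k) monoid_scheme \<Rightarrow> ('z \<Rightarrow> 'q \<Rightarrow> 'z) \<Rightarrow> ('z, 'q, 'l) ext \<Rightarrow> bool" where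
  "is_extension Z Q act (L, i, j) \<longleftrightarrow>
     loop L \<and> i \<in> mon Z L \<and> j \<in> epi L Q \<and> kernel L Q j = i ` carrier Z \<and>
     (\<forall>u\<in>carrier L. \<forall>v\<in>carrier L. \<forall>w\<in>carrier L.
        u \<in> i ` carrier Z \<or> v \<in> i ` carrier Z \<or> w \<in> i ` carrier Z \<longrightarrow>
        (u \<otimes>\<^bsub>L\<^esub> v) \<otimes>\<^bsub>L\<^esub> w = u \<otimes>\<^bsub>L\<^esub> (v \<otimes>\<^bsub>L\<^esub> w)) \<and>
     (\<forall>z\<in>carrier Z. \<forall>l\<in>carrier L. i z \<otimes>\<^bsub>L\<^esub> l = l \<otimes>\<^bsub>L\<^esub> i (act z (j l)))"

fun equivalent_ext :: "('z, 'm) monoid_scheme \<Rightarrow> ('z, 'q, 'l) ext \<Rightarrow> ('z, 'q, 'l) ext \<Rightarrow> bool" where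
  "equivalent_ext Z (L, iL, jL) (M, iM, jM) \<longleftrightarrow>
     (\<exists>\<phi>\<in>hom M L. (\<forall>z\<in>carrier Z. \<phi> (iM z) = iL z) \<and> (\<forall>m\<in>carrier M. jL (\<phi> m) = jM m))"

text \<open>\<open>Start s\<close> is the pair \<open>a\<^sub>s a\<^sub>s\<^sub>+\<^sub>1\<close>; the outermost constructor is the last step.\<close>

datatype bracketing = Start nat | LeftStep bracketing | RightStep bracketing

primrec left_end :: "bracketing \<Rightarrow> nat" where
  "left_end (Start s) = s"
| "left_end (LeftStep P) = left_end P - 1"
| "left_end (RightStep P) = left_end P"

primrec right_end :: "bracketing \<Rightarrow> nat" where
  "right_end (Start s) = s + 1"
| "right_end (LeftStep P) = right_end P"
| "right_end (RightStep P) = right_end P + 1"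

text \<open>All intermediate intervals lie in \<open>{1..n}\<close>; this also excludes truncated subtraction in
  \<^const>\<open>left_end\<close>.\<close>

primrec bracketing_within :: "nat \<Rightarrow> bracketing \<Rightarrow> bool" where
  "bracketing_within n (Start s) \<longleftrightarrow> 1 \<le> s \<and> s + 1 \<le> n"
| "bracketing_within n (LeftStep P) \<longleftrightarrow> bracketing_within n P \<and> 1 < left_end P"
| "bracketing_within n (RightStep P) \<longleftrightarrow> bracketing_within n P \<and> right_end P < n"

definition one_nested_bracketing :: "nat \<Rightarrow> bracketing \<Rightarrow> bool" where
  "one_nested_bracketing n P \<longleftrightarrow> bracketing_within n P \<and> left_end P = 1 \<and> right_end P = n"

definition last_step_right :: "bracketing \<Rightarrow> bool" where
  "last_step_right P \<longleftrightarrow> (\<exists>P'. P = RightStep P')"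

primrec bracket_prod :: "('q, 'k) monoid_scheme \<Rightarrow> (nat \<Rightarrow> 'q) \<Rightarrow> bracketing \<Rightarrow> 'q" where
  "bracket_prod Q a (Start s) = a s \<otimes>\<^bsub>Q\<^esub> a (s + 1)"
| "bracket_prod Q a (LeftStep P) = a (left_end P - 1) \<otimes>\<^bsub>Q\<^esub> bracket_prod Q a P"
| "bracket_prod Q a (RightStep P) = bracket_prod Q a P \<otimes>\<^bsub>Q\<^esub> a (right_end P + 1)"

text \<open>For \<open>i \<le> n\<close> this is \<open>a\<^sub>i (a\<^sub>i\<^sub>+\<^sub>1 (\<dots> (a\<^sub>n\<^sub>-\<^sub>1 a\<^sub>n) \<dots>))\<close>.\<close>

definition right_nested :: "('q, 'k) monoid_scheme \<Rightarrow> (nat \<Rightarrow> 'q) \<Rightarrow> nat \<Rightarrow> nat \<Rightarrow> 'q" where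
  "right_nested Q a i n = foldr (\<lambda>x y. x \<otimes>\<^bsub>Q\<^esub> y) (map a [i..<n]) (a n)"

text \<open>\<open>letter (x\<^sub>1, x\<^sub>2, x\<^sub>3) k\<close> is \<open>x\<^sub>k\<close> for \<open>k \<in> {1, 2, 3}\<close>.\<close>

fun letter :: "'q \<times> 'q \<times> 'q \<Rightarrow> nat \<Rightarrow> 'q" where
  "letter (x1, x2, x3) k = (if k = 1 then x1 else if k = 2 then x2 else x3)"

definition satisfies_identity ::
    "('q, 'k) monoid_scheme \<Rightarrow> nat \<Rightarrow> (nat \<Rightarrow> nat) \<Rightarrow> bracketing \<Rightarrow> bool" where
  "satisfies_identity Q n \<rho> P \<longleftrightarrow>
     (\<forall>x \<in> carrier Q \<times> carrier Q \<times> carrier Q.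
        right_nested Q (\<lambda>k. letter x (\<rho> k)) 1 n = bracket_prod Q (\<lambda>k. letter x (\<rho> k)) P)"

text \<open>
  Cochain groups carry the pointwise operation. Cochains are extensional functions, so that
  they are determined by their values on the carrier of \<open>Q\<close>.
\<close>

definition C1 :: "('q, 'k) monoid_scheme \<Rightarrow> ('z, 'm) monoid_scheme \<Rightarrow> ('q \<Rightarrow> 'z) monoid" where
  "C1 Q Z = (product_group (carrier Q) (\<lambda>_. Z))
     \<lparr>carrier := {h \<in> carrier Q \<rightarrow>\<^sub>E carrier Z. h \<one>\<^bsub>Q\<^esub> = \<one>\<^bsub>Z\<^esub>}\<rparr>"

definition C2 :: "('q, 'k) monoid_scheme \<Rightarrow> ('z, 'm) monoid_scheme \<Rightarrow> ('q \<times> 'q \<Rightarrow> 'z) monoid" where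
  "C2 Q Z = (product_group (carrier Q \<times> carrier Q) (\<lambda>_. Z))
     \<lparr>carrier := {f \<in> carrier Q \<times> carrier Q \<rightarrow>\<^sub>E carrier Z.
        \<forall>x\<in>carrier Q. f (x, \<one>\<^bsub>Q\<^esub>) = \<one>\<^bsub>Z\<^esub> \<and> f (\<one>\<^bsub>Q\<^esub>, x) = \<one>\<^bsub>Z\<^esub>}\<rparr>"

definition C3 :: "('q, 'k) monoid_scheme \<Rightarrow> ('z, 'm) monoid_scheme \<Rightarrow> ('q \<times> 'q \<times> 'q \<Rightarrow> 'z) monoid" where
  "C3 Q Z = product_group (carrier Q \<times> carrier Q \<times> carrier Q) (\<lambda>_. Z)"

definition \<delta>1 ::
    "('q, 'k) monoid_scheme \<Rightarrow> ('z, 'm) monoid_scheme \<Rightarrow> ('z \<Rightarrow> 'q \<Rightarrow> 'z) \<Rightarrow>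
     ('q \<Rightarrow> 'z) \<Rightarrow> ('q \<times> 'q \<Rightarrow> 'z)" where
  "\<delta>1 Q Z act h = (\<lambda>(x, y) \<in> carrier Q \<times> carrier Q.
     h y \<otimes>\<^bsub>Z\<^esub> inv\<^bsub>Z\<^esub> h (x \<otimes>\<^bsub>Q\<^esub> y) \<otimes>\<^bsub>Z\<^esub> act (h x) y)"

primrec factor_sum ::
    "('q, 'k) monoid_scheme \<Rightarrow> ('z, 'm) monoid_scheme \<Rightarrow> ('z \<Rightarrow> 'q \<Rightarrow> 'z) \<Rightarrow>
     ('q \<times> 'q \<Rightarrow> 'z) \<Rightarrow> (nat \<Rightarrow> 'q) \<Rightarrow> bracketing \<Rightarrow> 'z" where
  "factor_sum Q Z act f a (Start s) = f (a s, a (s + 1))"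
| "factor_sum Q Z act f a (LeftStep P) =
     f (a (left_end P - 1), bracket_prod Q a P) \<otimes>\<^bsub>Z\<^esub> factor_sum Q Z act f a P"
| "factor_sum Q Z act f a (RightStep P) =
     f (bracket_prod Q a P, a (right_end P + 1)) \<otimes>\<^bsub>Z\<^esub>
     act (factor_sum Q Z act f a P) (a (right_end P + 1))"

definition \<delta>2 ::
    "('q, 'k) monoid_scheme \<Rightarrow> ('z, 'm) monoid_scheme \<Rightarrow> ('z \<Rightarrow> 'q \<Rightarrow> 'z) \<Rightarrow> nat \<Rightarrow> bracketing \<Rightarrow>
     ('q \<times> 'q \<Rightarrow> 'z) \<Rightarrow> (nat \<Rightarrow> 'q) \<Rightarrow> 'z" where
  "\<delta>2 Q Z act n P f a = factor_sum Q Z act f a P \<otimes>\<^bsub>Z\<^esub>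
     inv\<^bsub>Z\<^esub> (\<Otimes>\<^bsub>Z\<^esub>i\<in>{1..n - 1}. f (a i, right_nested Q a (i + 1) n))"

definition \<delta>\<rho> ::
    "('q, 'k) monoid_scheme \<Rightarrow> ('z, 'm) monoid_scheme \<Rightarrow> ('z \<Rightarrow> 'q \<Rightarrow> 'z) \<Rightarrow> nat \<Rightarrow>
     (nat \<Rightarrow> nat) \<Rightarrow> bracketing \<Rightarrow> ('q \<times> 'q \<Rightarrow> 'z) \<Rightarrow> ('q \<times> 'q \<times> 'q \<Rightarrow> 'z)" where
  "\<delta>\<rho> Q Z act n \<rho> P f = (\<lambda>x \<in> carrier Q \<times> carrier Q \<times> carrier Q.
     \<delta>2 Q Z act n P f (\<lambda>k. letter x (\<rho> k)))"

definition H2 ::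
    "('q, 'k) monoid_scheme \<Rightarrow> ('z, 'm) monoid_scheme \<Rightarrow> ('z \<Rightarrow> 'q \<Rightarrow> 'z) \<Rightarrow> nat \<Rightarrow>
     (nat \<Rightarrow> nat) \<Rightarrow> bracketing \<Rightarrow> ('q \<times> 'q \<Rightarrow> 'z) set monoid" where
  "H2 Q Z act n \<rho> P =
     (C2 Q Z)\<lparr>carrier := kernel (C2 Q Z) (C3 Q Z) (\<delta>\<rho> Q Z act n \<rho> P)\<rparr>
       Mod (\<delta>1 Q Z act ` carrier (C1 Q Z))"

text \<open>
  HOL cannot quantify over loops of all types inside a formula, so the underlying set of an
  extension is a subset of a type \<open>'l\<close>. Every extension of \<open>Q\<close> by \<open>Z\<close> is equipotent to
  \<open>Q \<times> Z\<close>; hence, as soon as \<open>'l\<close> has room for \<open>Q \<times> Z\<close>, these sets represent all extensions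
  up to equivalence. Two triples that differ only outside the carriers are equivalent.
\<close>

definition extensions_satisfying ::
    "('q, 'k) monoid_scheme \<Rightarrow> ('z, 'm) monoid_scheme \<Rightarrow> ('z \<Rightarrow> 'q \<Rightarrow> 'z) \<Rightarrow> nat \<Rightarrow>
     (nat \<Rightarrow> nat) \<Rightarrow> bracketing \<Rightarrow> ('z, 'q, 'l) ext set" where
  "extensions_satisfying Q Z act n \<rho> P =
     {E. is_extension Z Q act E \<and> satisfies_identity (fst E) n \<rho> P}"

definition ext_equivalence ::
    "('q, 'k) monoid_scheme \<Rightarrow> ('z, 'm) monoid_scheme \<Rightarrow> ('z \<Rightarrow> 'q \<Rightarrow> 'z) \<Rightarrow> nat \<Rightarrow>
     (nat \<Rightarrow> nat) \<Rightarrow> bracketing \<Rightarrow> (('z, 'q, 'l) ext \<times> ('z, 'q, 'l) ext) set" where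
  "ext_equivalence Q Z act n \<rho> P =
     {(E, E'). E \<in> extensions_satisfying Q Z act n \<rho> P \<and>
               E' \<in> extensions_satisfying Q Z act n \<rho> P \<and> equivalent_ext Z E E'}"

end

theory Submission
  imports Defs
begin

text \<open>
  The proof is Schreier's description of group extensions by factor sets, adapted to loops.

  Let \<open>s\<close> be a section of the projection \<open>j\<close> of an extension \<open>L\<close> with \<open>s(e) = e\<close>. Since \<open>L\<close> is a
  loop and the elements of \<open>Z\<close> associate with everything, every element of \<open>L\<close> is uniquely
  \<open>s(x) a\<close> with \<open>x \<in> Q\<close> and \<open>a \<in> Z\<close>, and \<open>s(x) s(y) = s(xy) f(x, y)\<close> defines a factor set
  \<open>f \<in> C\<^sup>2(Q, Z)\<close>. In these coordinates the multiplication of \<open>L\<close> is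
  \<open>(x, a)(y, b) = (xy, f(x, y) + a y + b)\<close> (\<open>coordinates_of_factor_set\<close>), and conversely this
  formula defines an extension for every \<open>f \<in> C\<^sup>2(Q, Z)\<close> (\<open>extension_with_factor_set\<close>);
  associativity of \<open>L\<close> is what would constrain \<open>f\<close> by the usual cocycle condition.

  The identity brings in the cocycle condition. Multiply out both of its sides in coordinates, for
  letters \<open>(x\<^sub>k, z\<^sub>k)\<close>. In a one nested bracketing, and in the right nested one, each \<open>z\<^sub>k\<close> ends up
  acted on by \<open>x\<^sub>k\<^sub>+\<^sub>1, \<dots>, x\<^sub>n\<close> in this order: a left step acts on the new letter by a product of the
  letters to its right, and an action makes no difference between bracketings of that product; a
  right step acts on everything by the new letter. So both sides carry the same contribution of
  the \<open>z\<^sub>k\<close>. It cancels, and what remains says that \<open>f\<close> lies in the kernel of \<open>\<delta>\<^sub>\<rho>\<close>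
  (\<open>identity_iff_cocycle\<close>).

  Replacing the section \<open>s(x)\<close> by \<open>s(x) h(x)\<close> adds \<open>\<delta>h\<close> to \<open>f\<close>, so that the factor sets of one
  extension form a full coset of \<open>\<delta>(C\<^sup>1(Q, Z))\<close> (\<open>factor_class_coset\<close>). An equivalence carries
  sections to sections without changing the factor set, and two extensions with a common factor
  set have the same coordinate description; hence extensions are equivalent exactly if their
  cosets agree (\<open>equivalent_iff_factor_class_eq\<close>). Sending an extension to its coset is therefore
  the required correspondence.
\<close>

section \<open>Loops\<close>

context loop
begin

lemma l_cancel [simp]:
  assumes "a \<in> carrier Q" "b \<in> carrier Q" "c \<in> carrier Q"
  shows "a \<otimes> b = a \<otimes> c \<longleftrightarrow> b = c"
  using l_translation[OF assms(1)] assms by (auto simp: bij_betw_def inj_on_def)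

lemma l_solve:
  assumes "a \<in> carrier Q" "c \<in> carrier Q"
  obtains b where "b \<in> carrier Q" "a \<otimes> b = c"
  using l_translation[OF assms(1)] assms(2) unfolding bij_betw_def
  by (metis (no_types, lifting) imageE)

lemma r_cancel [simp]:
  assumes "a \<in> carrier Q" "b \<in> carrier Q" "c \<in> carrier Q"
  shows "b \<otimes> a = c \<otimes> a \<longleftrightarrow> b = c"
  using r_translation[OF assms(1)] assms by (auto simp: bij_betw_def inj_on_def)

lemma r_solve:
  assumes "a \<in> carrier Q" "c \<in> carrier Q"
  obtains b where "b \<in> carrier Q" "b \<otimes> a = c"
  using r_translation[OF assms(1)] assms(2) unfolding bij_betw_def
  by (metis (no_types, lifting) imageE)

lemma idempotent_is_one:
  assumes "a \<otimes> a = a" "a \<in> carrier Q"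
  shows "a = \<one>"
  using l_cancel[of a a \<one>] assms r_one one_closed by simp

end

section \<open>Actions, cochains and coordinates\<close>

locale loop_action = Q: loop Q + Z: comm_group Z
  for Q :: "('q, 'k) monoid_scheme" and Z :: "('z, 'm) monoid_scheme" +
  fixes act :: "'z \<Rightarrow> 'q \<Rightarrow> 'z"
  assumes action: "is_action Z Q act"
begin

lemmas Q_simps [simp] = Q.m_closed Q.one_closed Q.l_one Q.r_one

lemma act_iso: "a \<in> carrier Q \<Longrightarrow> (\<lambda>z. act z a) \<in> iso Z Z"
  using action by (simp add: is_action_def)

lemma act_closed [simp]: "\<lbrakk>z \<in> carrier Z; a \<in> carrier Q\<rbrakk> \<Longrightarrow> act z a \<in> carrier Z"
  using act_iso by (force simp: iso_def hom_def)

lemma act_mult [simp]: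
  "\<lbrakk>z \<in> carrier Z; w \<in> carrier Z; a \<in> carrier Q\<rbrakk>
    \<Longrightarrow> act (z \<otimes>\<^bsub>Z\<^esub> w) a = act z a \<otimes>\<^bsub>Z\<^esub> act w a"
  using act_iso by (force simp: iso_def hom_def)

lemma act_one [simp]: "z \<in> carrier Z \<Longrightarrow> act z \<one>\<^bsub>Q\<^esub> = z"
  using action by (simp add: is_action_def)

lemma act_prod:
  "\<lbrakk>z \<in> carrier Z; a \<in> carrier Q; b \<in> carrier Q\<rbrakk> \<Longrightarrow> act z (a \<otimes>\<^bsub>Q\<^esub> b) = act (act z a) b"
  using action by (simp add: is_action_def)

lemma act_neutral [simp]: "a \<in> carrier Q \<Longrightarrow> act \<one>\<^bsub>Z\<^esub> a = \<one>\<^bsub>Z\<^esub>"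
  by (metis Z.one_closed Z.l_one Z.r_cancel_one act_closed act_mult)

lemma act_eq_iff [simp]:
  "\<lbrakk>z \<in> carrier Z; w \<in> carrier Z; a \<in> carrier Q\<rbrakk> \<Longrightarrow> act z a = act w a \<longleftrightarrow> z = w"
  using act_iso[of a] by (auto simp: iso_def bij_betw_def inj_on_def)

lemma act_surj:
  assumes "a \<in> carrier Q" "w \<in> carrier Z"
  obtains z where "z \<in> carrier Z" "act z a = w"
proof -
  have "w \<in> (\<lambda>z. act z a) ` carrier Z"
    using act_iso[OF assms(1)] assms(2) by (simp add: iso_def bij_betw_def)
  then show ?thesis
    using that by auto
qed

lemma mult_inv_eq_one_iff:
  assumes "z \<in> carrier Z" "w \<in> carrier Z"
  shows "z \<otimes>\<^bsub>Z\<^esub> inv\<^bsub>Z\<^esub> w = \<one>\<^bsub>Z\<^esub> \<longleftrightarrow> z = w"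
  using assms Z.inv_solve_right[of "\<one>\<^bsub>Z\<^esub>" z w] by auto

lemma C1I:
  assumes "h \<in> extensional (carrier Q)" "\<And>x. x \<in> carrier Q \<Longrightarrow> h x \<in> carrier Z"
    and "h \<one>\<^bsub>Q\<^esub> = \<one>\<^bsub>Z\<^esub>"
  shows "h \<in> carrier (C1 Q Z)"
  using assms by (auto simp: C1_def PiE_def)

lemma C2I:
  assumes "f \<in> extensional (carrier Q \<times> carrier Q)"
    and "\<And>x y. \<lbrakk>x \<in> carrier Q; y \<in> carrier Q\<rbrakk> \<Longrightarrow> f (x, y) \<in> carrier Z"
    and "\<And>x. x \<in> carrier Q \<Longrightarrow> f (x, \<one>\<^bsub>Q\<^esub>) = \<one>\<^bsub>Z\<^esub>"
    and "\<And>x. x \<in> carrier Q \<Longrightarrow> f (\<one>\<^bsub>Q\<^esub>, x) = \<one>\<^bsub>Z\<^esub>"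
  shows "f \<in> carrier (C2 Q Z)"
  using assms by (auto simp: C2_def PiE_def)

lemma C2_extensional: "f \<in> carrier (C2 Q Z) \<Longrightarrow> f \<in> extensional (carrier Q \<times> carrier Q)"
  by (auto simp: C2_def PiE_def)

lemma C2_closed:
  "\<lbrakk>f \<in> carrier (C2 Q Z); x \<in> carrier Q; y \<in> carrier Q\<rbrakk> \<Longrightarrow> f (x, y) \<in> carrier Z"
  by (auto simp: C2_def)

lemma C2_normalized:
  assumes "f \<in> carrier (C2 Q Z)" "x \<in> carrier Q"
  shows "f (x, \<one>\<^bsub>Q\<^esub>) = \<one>\<^bsub>Z\<^esub>" "f (\<one>\<^bsub>Q\<^esub>, x) = \<one>\<^bsub>Z\<^esub>"
  using assms by (auto simp: C2_def)

lemma C1_closed: "\<lbrakk>h \<in> carrier (C1 Q Z); x \<in> carrier Q\<rbrakk> \<Longrightarrow> h x \<in> carrier Z"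
  by (auto simp: C1_def)

lemma C1_normalized: "h \<in> carrier (C1 Q Z) \<Longrightarrow> h \<one>\<^bsub>Q\<^esub> = \<one>\<^bsub>Z\<^esub>"
  by (auto simp: C1_def)

lemma C2_mult:
  "\<lbrakk>x \<in> carrier Q; y \<in> carrier Q\<rbrakk> \<Longrightarrow> (g \<otimes>\<^bsub>C2 Q Z\<^esub> f) (x, y) = g (x, y) \<otimes>\<^bsub>Z\<^esub> f (x, y)"
  by (simp add: C2_def)

lemma C2_mult_extensional: "g \<otimes>\<^bsub>C2 Q Z\<^esub> f \<in> extensional (carrier Q \<times> carrier Q)"
  by (simp add: C2_def)

lemma coboundary_mult_closed:
  assumes h: "h \<in> carrier (C1 Q Z)" and f: "f \<in> carrier (C2 Q Z)"
  shows "\<delta>1 Q Z act h \<otimes>\<^bsub>C2 Q Z\<^esub> f \<in> carrier (C2 Q Z)"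
  by (rule C2I)
    (simp_all add: C2_mult C2_mult_extensional \<delta>1_def
      C1_closed[OF h] C1_normalized[OF h] C2_closed[OF f] C2_normalized[OF f])

lemma C2_eqI:
  assumes "f \<in> carrier (C2 Q Z)" "g \<in> carrier (C2 Q Z)"
    and "\<And>x y. \<lbrakk>x \<in> carrier Q; y \<in> carrier Q\<rbrakk> \<Longrightarrow> f (x, y) = g (x, y)"
  shows "f = g"
proof (rule extensionalityI)
  show "f \<in> extensional (carrier Q \<times> carrier Q)" "g \<in> extensional (carrier Q \<times> carrier Q)"
    using assms(1,2) by (simp_all add: C2_extensional)
qed (use assms(3) in auto)

text \<open>
  The right-hand side is the form in which a change of section produces the coboundary: it compares
  the coordinates of \<open>s(xy) h(xy) g(x, y)\<close> with those of \<open>(s(x) h(x)) (s(y) h(y))\<close>.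
\<close>

lemma coboundary_mult_eq_iff:
  assumes h: "h \<in> carrier (C1 Q Z)" and f: "f \<in> carrier (C2 Q Z)"
    and g: "g \<in> carrier Z" and xy: "x \<in> carrier Q" "y \<in> carrier Q"
  shows "g = (\<delta>1 Q Z act h \<otimes>\<^bsub>C2 Q Z\<^esub> f) (x, y) \<longleftrightarrow>
    h (x \<otimes>\<^bsub>Q\<^esub> y) \<otimes>\<^bsub>Z\<^esub> g = f (x, y) \<otimes>\<^bsub>Z\<^esub> act (h x) y \<otimes>\<^bsub>Z\<^esub> h y"
proof -
  let ?c = "h (x \<otimes>\<^bsub>Q\<^esub> y)" and ?r = "f (x, y) \<otimes>\<^bsub>Z\<^esub> act (h x) y \<otimes>\<^bsub>Z\<^esub> h y"
  have c: "?c \<in> carrier Z" and r: "?r \<in> carrier Z"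
    using xy by (simp_all add: C1_closed[OF h] C2_closed[OF f])
  have "(\<delta>1 Q Z act h \<otimes>\<^bsub>C2 Q Z\<^esub> f) (x, y) = inv\<^bsub>Z\<^esub> ?c \<otimes>\<^bsub>Z\<^esub> ?r"
    using xy by (simp add: C2_mult \<delta>1_def C1_closed[OF h] C2_closed[OF f] Z.m_ac)
  then show ?thesis
    using c r g Z.inv_solve_left[of g ?c ?r] by auto
qed

text \<open>
  The extension is the twisted product \<open>Q \<times> Z\<close> with factor set \<open>f\<close>, up to the bijection \<open>p\<close>.
  Keeping \<open>p\<close> abstract covers both the decomposition of a given extension and the
  construction of one on an arbitrary type that is large enough.
\<close>

definition coordinates ::
    "('q \<times> 'q \<Rightarrow> 'z) \<Rightarrow> ('z, 'q, 'l) ext \<Rightarrow> ('q \<times> 'z \<Rightarrow> 'l) \<Rightarrow> bool" where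
  "coordinates f = (\<lambda>(L, i, j) p.
     bij_betw p (carrier Q \<times> carrier Z) (carrier L) \<and>
     (\<forall>x\<in>carrier Q. \<forall>a\<in>carrier Z. \<forall>y\<in>carrier Q. \<forall>b\<in>carrier Z.
        p (x, a) \<otimes>\<^bsub>L\<^esub> p (y, b) = p (x \<otimes>\<^bsub>Q\<^esub> y, f (x, y) \<otimes>\<^bsub>Z\<^esub> act a y \<otimes>\<^bsub>Z\<^esub> b)) \<and>
     \<one>\<^bsub>L\<^esub> = p (\<one>\<^bsub>Q\<^esub>, \<one>\<^bsub>Z\<^esub>) \<and>
     (\<forall>a\<in>carrier Z. i a = p (\<one>\<^bsub>Q\<^esub>, a)) \<and>
     (\<forall>x\<in>carrier Q. \<forall>a\<in>carrier Z. j (p (x, a)) = x))"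

end

locale coordinatized = loop_action Q Z act
  for Q :: "('q, 'k) monoid_scheme" and Z :: "('z, 'm) monoid_scheme" and act +
  fixes f :: "'q \<times> 'q \<Rightarrow> 'z" and L :: "'l monoid" and i :: "'z \<Rightarrow> 'l" and j :: "'l \<Rightarrow> 'q"
    and p :: "'q \<times> 'z \<Rightarrow> 'l"
  assumes f [simp]: "f \<in> carrier (C2 Q Z)"
    and coordinates: "coordinates f (L, i, j) p"
begin

lemmas f_simps [simp] = C2_closed[OF f] C2_normalized[OF f]

lemma bij: "bij_betw p (carrier Q \<times> carrier Z) (carrier L)"
  and mult [simp]: "\<lbrakk>x \<in> carrier Q; a \<in> carrier Z; y \<in> carrier Q; b \<in> carrier Z\<rbrakk> \<Longrightarrow>
    p (x, a) \<otimes>\<^bsub>L\<^esub> p (y, b) = p (x \<otimes>\<^bsub>Q\<^esub> y, f (x, y) \<otimes>\<^bsub>Z\<^esub> act a y \<otimes>\<^bsub>Z\<^esub> b)"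
  and one: "\<one>\<^bsub>L\<^esub> = p (\<one>\<^bsub>Q\<^esub>, \<one>\<^bsub>Z\<^esub>)"
  and embed: "a \<in> carrier Z \<Longrightarrow> i a = p (\<one>\<^bsub>Q\<^esub>, a)"
  and proj [simp]: "\<lbrakk>x \<in> carrier Q; a \<in> carrier Z\<rbrakk> \<Longrightarrow> j (p (x, a)) = x"
  using coordinates by (auto simp: coordinates_def)

lemma p_closed [simp]: "\<lbrakk>x \<in> carrier Q; a \<in> carrier Z\<rbrakk> \<Longrightarrow> p (x, a) \<in> carrier L"
  using bij by (auto simp: bij_betw_def)

lemma p_eq_iff [simp]:
  "\<lbrakk>x \<in> carrier Q; a \<in> carrier Z; y \<in> carrier Q; b \<in> carrier Z\<rbrakk> \<Longrightarrow>
    p (x, a) = p (y, b) \<longleftrightarrow> x = y \<and> a = b"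
  using bij by (auto simp: bij_betw_def inj_on_def)

lemma carrier_cases:
  assumes "l \<in> carrier L"
  obtains x a where "x \<in> carrier Q" "a \<in> carrier Z" "l = p (x, a)"
  using bij assms unfolding bij_betw_def by (metis (no_types, lifting) SigmaE imageE)

lemma embed_image: "l \<in> i ` carrier Z \<longleftrightarrow> (\<exists>a\<in>carrier Z. l = p (\<one>\<^bsub>Q\<^esub>, a))"
  using embed by auto

text \<open>
  In \<open>(x, a)(y, b) = (xy, f(x, y) + a y + b)\<close> an equation is first solved in \<open>Q\<close>; with \<open>x\<close> and
  \<open>y\<close> known, \<open>b\<close> is found by subtraction, and \<open>a\<close> because \<open>y\<close> acts bijectively.
\<close>

lemma loop_L: "loop L"
proof
  fix u assume u: "u \<in> carrier L"
  then obtain x a where [simp]: "x \<in> carrier Q" "a \<in> carrier Z" and u_eq: "u = p (x, a)"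
    by (rule carrier_cases)
  show "\<one>\<^bsub>L\<^esub> \<otimes>\<^bsub>L\<^esub> u = u" "u \<otimes>\<^bsub>L\<^esub> \<one>\<^bsub>L\<^esub> = u"
    by (simp_all add: u_eq one)
  show "bij_betw (\<lambda>v. u \<otimes>\<^bsub>L\<^esub> v) (carrier L) (carrier L)"
    unfolding bij_betw_def
  proof
    show "inj_on (\<lambda>v. u \<otimes>\<^bsub>L\<^esub> v) (carrier L)"
      by (rule inj_onI) (auto simp: u_eq elim!: carrier_cases)
    show "(\<lambda>v. u \<otimes>\<^bsub>L\<^esub> v) ` carrier L = carrier L"
    proof (intro equalityI subsetI)
      fix w assume "w \<in> carrier L"
      then obtain z c where [simp]: "z \<in> carrier Q" "c \<in> carrier Z" and w: "w = p (z, c)"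
        by (rule carrier_cases)
      obtain y where y [simp]: "y \<in> carrier Q" "x \<otimes>\<^bsub>Q\<^esub> y = z"
        by (rule Q.l_solve[of x z]) auto
      let ?d = "f (x, y) \<otimes>\<^bsub>Z\<^esub> act a y"
      have "u \<otimes>\<^bsub>L\<^esub> p (y, inv\<^bsub>Z\<^esub> ?d \<otimes>\<^bsub>Z\<^esub> c) = p (z, ?d \<otimes>\<^bsub>Z\<^esub> (inv\<^bsub>Z\<^esub> ?d \<otimes>\<^bsub>Z\<^esub> c))"
        by (simp add: u_eq)
      also have "?d \<otimes>\<^bsub>Z\<^esub> (inv\<^bsub>Z\<^esub> ?d \<otimes>\<^bsub>Z\<^esub> c) = c"
        by (subst Z.m_assoc[symmetric]) simp_all
      finally show "w \<in> (\<lambda>v. u \<otimes>\<^bsub>L\<^esub> v) ` carrier L"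
        unfolding w by (rule image_eqI[OF sym]) simp
    qed (auto simp: u_eq elim!: carrier_cases)
  qed
  show "bij_betw (\<lambda>v. v \<otimes>\<^bsub>L\<^esub> u) (carrier L) (carrier L)"
    unfolding bij_betw_def
  proof
    show "inj_on (\<lambda>v. v \<otimes>\<^bsub>L\<^esub> u) (carrier L)"
      by (rule inj_onI) (auto simp: u_eq elim!: carrier_cases)
    show "(\<lambda>v. v \<otimes>\<^bsub>L\<^esub> u) ` carrier L = carrier L"
    proof (intro equalityI subsetI)
      fix w assume "w \<in> carrier L"
      then obtain z c where [simp]: "z \<in> carrier Q" "c \<in> carrier Z" and w: "w = p (z, c)"
        by (rule carrier_cases)
      obtain y where y [simp]: "y \<in> carrier Q" "y \<otimes>\<^bsub>Q\<^esub> x = z"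
        by (rule Q.r_solve[of x z]) auto
      let ?d = "f (y, x) \<otimes>\<^bsub>Z\<^esub> a"
      define e where "e = inv\<^bsub>Z\<^esub> ?d \<otimes>\<^bsub>Z\<^esub> c"
      have e [simp]: "e \<in> carrier Z" "?d \<otimes>\<^bsub>Z\<^esub> e = c"
        by (simp_all add: e_def Z.m_assoc[symmetric] del: Z.inv_mult_group)
      obtain b where b [simp]: "b \<in> carrier Z" "act b x = e"
        by (rule act_surj[of x e]) auto
      have "p (y, b) \<otimes>\<^bsub>L\<^esub> u = p (z, f (y, x) \<otimes>\<^bsub>Z\<^esub> e \<otimes>\<^bsub>Z\<^esub> a)"
        by (simp add: u_eq)
      also have "f (y, x) \<otimes>\<^bsub>Z\<^esub> e \<otimes>\<^bsub>Z\<^esub> a = ?d \<otimes>\<^bsub>Z\<^esub> e"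
        by (simp only: Z.m_ac \<open>a \<in> carrier Z\<close> e(1) f_simps \<open>x \<in> carrier Q\<close> y(1) Z.m_closed)
      also have "\<dots> = c"
        by simp
      finally show "w \<in> (\<lambda>v. v \<otimes>\<^bsub>L\<^esub> u) ` carrier L"
        unfolding w by (rule image_eqI[OF sym]) simp
    qed (auto simp: u_eq elim!: carrier_cases)
  qed
qed (auto simp: one elim!: carrier_cases)

text \<open>
  Elements of \<open>Z\<close> associate with everything because \<open>f\<close> vanishes when one argument is neutral: if one
  of three factors has first coordinate \<open>e\<close>, both bracketings contain the same single value of
  \<open>f\<close>.
\<close>

lemma extension: "is_extension Z Q act (L, i, j)"
proof -
  have "i \<in> mon Z L"
    by (auto simp: mon_def hom_def inj_on_def embed)
  moreover have "j \<in> epi L Q"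
  proof -
    have "carrier Q \<subseteq> j ` carrier L"
      by (metis (no_types, lifting) Z.one_closed image_eqI p_closed proj subsetI)
    then show ?thesis
      by (auto simp: epi_def hom_def elim!: carrier_cases)
  qed
  moreover have "kernel L Q j = i ` carrier Z"
    by (auto simp: kernel_def embed elim!: carrier_cases)
  moreover have "(u \<otimes>\<^bsub>L\<^esub> v) \<otimes>\<^bsub>L\<^esub> w = u \<otimes>\<^bsub>L\<^esub> (v \<otimes>\<^bsub>L\<^esub> w)"
    if "u \<in> carrier L" "v \<in> carrier L" "w \<in> carrier L"
      "u \<in> i ` carrier Z \<or> v \<in> i ` carrier Z \<or> w \<in> i ` carrier Z" for u v w
    using that by (elim carrier_cases) (auto simp: embed_image act_prod Z.m_ac)
  moreover have "i z \<otimes>\<^bsub>L\<^esub> l = l \<otimes>\<^bsub>L\<^esub> i (act z (j l))" if "z \<in> carrier Z" "l \<in> carrier L" for z l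
    using that by (auto simp: embed Z.m_ac elim!: carrier_cases)
  ultimately show ?thesis
    by (simp add: loop_L)
qed

end

section \<open>The identity in coordinates\<close>

lemma bracketing_within_range:
  "bracketing_within n P \<Longrightarrow> 1 \<le> left_end P \<and> left_end P < right_end P \<and> right_end P \<le> n"
  by (induction P) auto

lemma right_nested_base: "right_nested Q a n n = a n"
  by (simp add: right_nested_def)

lemma right_nested_step:
  "k < n \<Longrightarrow> right_nested Q a k n = a k \<otimes>\<^bsub>Q\<^esub> right_nested Q a (Suc k) n"
  by (simp add: right_nested_def upt_conv_Cons)

context loop_action
begin

lemma bracket_prod_closed:
  assumes "\<And>k. x k \<in> carrier Q"
  shows "bracket_prod Q x P \<in> carrier Q"
  using assms by (induction P) auto

lemma right_nested_closed:
  assumes "\<And>k. x k \<in> carrier Q" "k \<le> n"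
  shows "right_nested Q x k n \<in> carrier Q"
  using assms(2) by (induction rule: inc_induct) (auto simp: assms right_nested_base right_nested_step)

lemma factor_sum_closed:
  assumes f: "f \<in> carrier (C2 Q Z)" and x: "\<And>k. x k \<in> carrier Q"
  shows "factor_sum Q Z act f x P \<in> carrier Z"
  by (induction P) (simp_all add: x bracket_prod_closed C2_closed[OF f])

text \<open>
  An action does not see the bracketing of a product, although \<open>Q\<close> may be far from associative:
  acting by a product is acting by its letters from left to right. This is why the
  \<open>Z\<close>-coordinates of the letters contribute equally to both sides of the identity.
\<close>

lemma act_bracket_prod:
  assumes x: "\<And>k. x k \<in> carrier Q" and "bracketing_within n P" "c \<in> carrier Z"
  shows "act c (bracket_prod Q x P) = foldl act c (map x [left_end P..<Suc (right_end P)])"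
  using assms(2,3)
proof (induction P arbitrary: c)
  case (Start s)
  then show ?case
    using x by (simp add: act_prod upt_rec)
next
  case (LeftStep P)
  have "[left_end P - 1..<Suc (right_end P)] =
      (left_end P - 1) # [left_end P..<Suc (right_end P)]"
    using LeftStep.prems bracketing_within_range[of n P] by (subst upt_conv_Cons) auto
  then show ?case
    using LeftStep x by (simp add: act_prod bracket_prod_closed del: upt_Suc)
next
  case (RightStep P)
  then show ?case
    using x bracketing_within_range[of n P] by (simp add: act_prod bracket_prod_closed)
qed

lemma act_right_nested:
  assumes x: "\<And>k. x k \<in> carrier Q" and "k \<le> n" "c \<in> carrier Z"
  shows "act c (right_nested Q x k n) = foldl act c (map x [k..<Suc n])"
  using assms(2,3)
proof (induction arbitrary: c rule: inc_induct)
  case base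
  then show ?case
    by (simp add: right_nested_base)
next
  case (step k)
  then have "[k..<Suc n] = k # [Suc k..<Suc n]"
    by (subst upt_conv_Cons) auto
  then show ?case
    using step x by (simp add: right_nested_step act_prod right_nested_closed del: upt_Suc)
qed

text \<open>
  This is \<open>\<Sum>\<^sub>k (\<dots>(z\<^sub>k x\<^sub>k\<^sub>+\<^sub>1)\<dots>)x\<^sub>r\<close> over the indices in the list, the last of which is \<open>r\<close>. The
  recursion matches a right step; \<open>twisted_sum_Cons\<close> is the corresponding rule for a left step.
\<close>

definition twisted_sum :: "(nat \<Rightarrow> 'q) \<Rightarrow> (nat \<Rightarrow> 'z) \<Rightarrow> nat list \<Rightarrow> 'z" where
  "twisted_sum x z ks = foldl (\<lambda>w k. act w (x k) \<otimes>\<^bsub>Z\<^esub> z k) \<one>\<^bsub>Z\<^esub> ks"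

lemma foldl_act_closed:
  assumes "\<And>k. x k \<in> carrier Q" "c \<in> carrier Z"
  shows "foldl act c (map x ks) \<in> carrier Z"
  using assms by (induction ks rule: rev_induct) auto

lemma twisted_sum_closed:
  assumes "\<And>k. x k \<in> carrier Q" "\<And>k. z k \<in> carrier Z"
  shows "twisted_sum x z ks \<in> carrier Z"
  using assms by (induction ks rule: rev_induct) (auto simp: twisted_sum_def)

lemma twisted_sum_snoc:
  "twisted_sum x z (ks @ [k]) = act (twisted_sum x z ks) (x k) \<otimes>\<^bsub>Z\<^esub> z k"
  by (simp add: twisted_sum_def)

lemma twisted_sum_Cons:
  assumes xz: "\<And>k. x k \<in> carrier Q" "\<And>k. z k \<in> carrier Z"
  shows "twisted_sum x z (k # ks) = foldl act (z k) (map x ks) \<otimes>\<^bsub>Z\<^esub> twisted_sum x z ks"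
proof (induction ks rule: rev_induct)
  case Nil
  then show ?case
    using xz by (simp add: twisted_sum_def)
next
  case (snoc m ks)
  then show ?case
    using xz twisted_sum_snoc[of x z "k # ks" m]
    by (simp add: twisted_sum_snoc foldl_act_closed twisted_sum_closed Z.m_assoc)
qed

end

context coordinatized
begin

text \<open>
  The \<open>Z\<close>-coordinate separates into the factor sum, which depends only on the \<open>x\<^sub>k\<close>, and a part
  that depends on \<open>P\<close> only through the interval of letters it has reached.
\<close>

lemma bracket_prod_coordinates:
  assumes xz: "\<And>k. x k \<in> carrier Q" "\<And>k. z k \<in> carrier Z" and "bracketing_within n P"
  shows "bracket_prod L (\<lambda>k. p (x k, z k)) P =
    p (bracket_prod Q x P, factor_sum Q Z act f x P \<otimes>\<^bsub>Z\<^esub>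
       twisted_sum x z [left_end P..<Suc (right_end P)])"
  using assms(3)
proof (induction P)
  case (Start s)
  then show ?case
    using xz by (simp add: twisted_sum_def upt_rec Z.m_assoc)
next
  case (LeftStep P)
  have split: "[left_end P - Suc 0..<Suc (right_end P)] =
      (left_end P - Suc 0) # [left_end P..<Suc (right_end P)]"
    using LeftStep.prems bracketing_within_range[of n P] by (subst upt_conv_Cons) auto
  show ?case
    using LeftStep xz
    by (simp add: split twisted_sum_Cons act_bracket_prod[where n = n, symmetric] bracket_prod_closed
        factor_sum_closed twisted_sum_closed Z.m_ac del: upt_Suc)
next
  case (RightStep P)
  have "left_end P \<le> Suc (right_end P)"
    using RightStep.prems bracketing_within_range[of n P] by simp
  then have split: "[left_end P..<Suc (Suc (right_end P))] =
      [left_end P..<Suc (right_end P)] @ [Suc (right_end P)]"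
    by simp
  show ?case
    using RightStep xz
    by (simp add: split twisted_sum_snoc bracket_prod_closed factor_sum_closed
        twisted_sum_closed Z.m_ac del: upt_Suc)
qed

lemma right_nested_coordinates:
  assumes xz: "\<And>k. x k \<in> carrier Q" "\<And>k. z k \<in> carrier Z" and "k \<le> n"
  shows "right_nested L (\<lambda>k. p (x k, z k)) k n =
    p (right_nested Q x k n, (\<Otimes>\<^bsub>Z\<^esub>m\<in>{k..<n}. f (x m, right_nested Q x (m + 1) n)) \<otimes>\<^bsub>Z\<^esub>
       twisted_sum x z [k..<Suc n])"
  using assms(3)
proof (induction rule: inc_induct)
  case base
  then show ?case
    using xz by (simp add: right_nested_base twisted_sum_def)
next
  case (step k)
  then have split: "[k..<Suc n] = k # [Suc k..<Suc n]"
    by (subst upt_conv_Cons) auto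
  have "{k..<n} = insert k {Suc k..<n}"
    using step.hyps by auto
  then have "(\<Otimes>\<^bsub>Z\<^esub>m\<in>{k..<n}. f (x m, right_nested Q x (m + 1) n)) =
      f (x k, right_nested Q x (Suc k) n) \<otimes>\<^bsub>Z\<^esub>
      (\<Otimes>\<^bsub>Z\<^esub>m\<in>{Suc k..<n}. f (x m, right_nested Q x (m + 1) n))"
    using xz step.hyps by (simp add: Z.finprod_insert Pi_def right_nested_closed)
  moreover have "(\<Otimes>\<^bsub>Z\<^esub>m\<in>{Suc k..<n}. f (x m, right_nested Q x (m + 1) n)) \<in> carrier Z"
    using xz by (intro Z.finprod_closed) (simp add: right_nested_closed)
  ultimately show ?case
    using step xz
    by (simp add: right_nested_step split twisted_sum_Cons act_right_nested[symmetric]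
        right_nested_closed twisted_sum_closed Z.m_ac del: upt_Suc)
qed

text \<open>
  The assumption on \<open>x\<close> makes the \<open>Q\<close>-coordinates of the two sides agree, so only the
  \<open>Z\<close>-coordinates are compared.
\<close>

lemma identity_iff_cocycle_at:
  assumes xz: "\<And>k. x k \<in> carrier Q" "\<And>k. z k \<in> carrier Z"
    and P: "one_nested_bracketing n P"
    and Q: "right_nested Q x 1 n = bracket_prod Q x P"
  shows "right_nested L (\<lambda>k. p (x k, z k)) 1 n = bracket_prod L (\<lambda>k. p (x k, z k)) P \<longleftrightarrow>
    \<delta>2 Q Z act n P f x = \<one>\<^bsub>Z\<^esub>"
proof -
  let ?N = "\<Otimes>\<^bsub>Z\<^esub>m\<in>{1..<n}. f (x m, right_nested Q x (m + 1) n)"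
  let ?F = "factor_sum Q Z act f x P" and ?T = "twisted_sum x z [1..<Suc n]"
  have ends: "bracketing_within n P" "left_end P = 1" "right_end P = n" and n: "1 < n"
    using P bracketing_within_range[of n P] by (auto simp: one_nested_bracketing_def)
  have closed: "?N \<in> carrier Z" "?F \<in> carrier Z" "?T \<in> carrier Z"
    using xz by (auto intro!: Z.finprod_closed
        simp: right_nested_closed factor_sum_closed twisted_sum_closed simp del: upt_Suc)
  have "right_nested L (\<lambda>k. p (x k, z k)) 1 n = bracket_prod L (\<lambda>k. p (x k, z k)) P \<longleftrightarrow>
      p (bracket_prod Q x P, ?N \<otimes>\<^bsub>Z\<^esub> ?T) = p (bracket_prod Q x P, ?F \<otimes>\<^bsub>Z\<^esub> ?T)"
    using right_nested_coordinates[of x z 1 n] bracket_prod_coordinates[of x z n P] xz ends n Q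
    by (simp del: upt_Suc)
  \<comment> \<open>The common contribution of the \<open>z\<^sub>k\<close> cancels; this leaves a condition on \<open>f\<close> alone.\<close>
  also have "\<dots> \<longleftrightarrow> ?F = ?N"
    using closed xz by (auto simp: bracket_prod_closed simp del: upt_Suc)
  also have "\<dots> \<longleftrightarrow> ?F \<otimes>\<^bsub>Z\<^esub> inv\<^bsub>Z\<^esub> ?N = \<one>\<^bsub>Z\<^esub>"
    using mult_inv_eq_one_iff[OF closed(2,1)] by (rule sym)
  also have "{1..<n} = {1..n - 1}"
    using n by auto
  finally show ?thesis
    by (simp add: \<delta>2_def)
qed

lemma identity_iff_cocycle:
  assumes P: "one_nested_bracketing n P" and Q: "satisfies_identity Q n \<rho> P"
  shows "satisfies_identity L n \<rho> P \<longleftrightarrow> f \<in> kernel (C2 Q Z) (C3 Q Z) (\<delta>\<rho> Q Z act n \<rho> P)"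
proof -
  let ?Q3 = "carrier Q \<times> carrier Q \<times> carrier Q" and ?Z3 = "carrier Z \<times> carrier Z \<times> carrier Z"
  let ?L3 = "carrier L \<times> carrier L \<times> carrier L"
  let ?p3 = "\<lambda>((x1, x2, x3), (z1, z2, z3)). (p (x1, z1), p (x2, z2), p (x3, z3))"
  let ?holds = "\<lambda>u. right_nested L (\<lambda>k. letter u (\<rho> k)) 1 n =
    bracket_prod L (\<lambda>k. letter u (\<rho> k)) P"
  have at: "?holds (?p3 (x, z)) \<longleftrightarrow> \<delta>2 Q Z act n P f (\<lambda>k. letter x (\<rho> k)) = \<one>\<^bsub>Z\<^esub>"
    if "x \<in> ?Q3" "z \<in> ?Z3" for x z
  proof -
    have "letter (?p3 (x, z)) k = p (letter x k, letter z k)" for k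
      by (cases x; cases z) auto
    moreover have "letter x k \<in> carrier Q" "letter z k \<in> carrier Z" for k
      using that by (cases x; cases z; auto)+
    moreover have "right_nested Q (\<lambda>k. letter x (\<rho> k)) 1 n =
        bracket_prod Q (\<lambda>k. letter x (\<rho> k)) P"
      using Q that(1) unfolding satisfies_identity_def by blast
    ultimately show ?thesis
      using identity_iff_cocycle_at[of "\<lambda>k. letter x (\<rho> k)" "\<lambda>k. letter z (\<rho> k)" n P] P
      by (simp only:)
  qed
  have L3: "?L3 = ?p3 ` (?Q3 \<times> ?Z3)"
  proof (intro equalityI subsetI)
    fix u assume "u \<in> ?L3"
    then obtain u1 u2 u3 where u: "u = (u1, u2, u3)"
      "u1 \<in> carrier L" "u2 \<in> carrier L" "u3 \<in> carrier L"
      by auto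
    obtain x1 z1 where 1: "x1 \<in> carrier Q" "z1 \<in> carrier Z" "u1 = p (x1, z1)"
      using u(2) by (rule carrier_cases)
    obtain x2 z2 where 2: "x2 \<in> carrier Q" "z2 \<in> carrier Z" "u2 = p (x2, z2)"
      using u(3) by (rule carrier_cases)
    obtain x3 z3 where 3: "x3 \<in> carrier Q" "z3 \<in> carrier Z" "u3 = p (x3, z3)"
      using u(4) by (rule carrier_cases)
    show "u \<in> ?p3 ` (?Q3 \<times> ?Z3)"
      using 1 2 3 by (intro image_eqI[of _ _ "((x1, x2, x3), (z1, z2, z3))"]) (auto simp: u)
  qed auto
  have "satisfies_identity L n \<rho> P \<longleftrightarrow> (\<forall>u\<in>?L3. ?holds u)"
    unfolding satisfies_identity_def ..
  also have "\<dots> \<longleftrightarrow> (\<forall>w\<in>?Q3 \<times> ?Z3. ?holds (?p3 w))"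
    unfolding L3 by (rule ball_simps(9))
  also have "\<dots> \<longleftrightarrow> (\<forall>x\<in>?Q3. \<forall>z\<in>?Z3. ?holds (?p3 (x, z)))"
    by (rule split_paired_Ball_Sigma)
  also have "\<dots> \<longleftrightarrow> (\<forall>x\<in>?Q3. \<delta>2 Q Z act n P f (\<lambda>k. letter x (\<rho> k)) = \<one>\<^bsub>Z\<^esub>)"
  proof -
    \<comment> \<open>Dropping the quantifier over \<open>z\<close> needs some element of its range.\<close>
    have "(\<one>\<^bsub>Z\<^esub>, \<one>\<^bsub>Z\<^esub>, \<one>\<^bsub>Z\<^esub>) \<in> ?Z3"
      by simp
    then show ?thesis
      using at by blast
  qed
  also have "\<dots> \<longleftrightarrow> \<delta>\<rho> Q Z act n \<rho> P f = \<one>\<^bsub>C3 Q Z\<^esub>"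
    by (auto simp: \<delta>\<rho>_def C3_def restrict_def fun_eq_iff)
  finally show ?thesis
    by (simp add: kernel_def)
qed

end

section \<open>Factor sets of an extension\<close>

context loop_action
begin

text \<open>
  Factor sets are tied to normalized sections: \<open>s(e) = e\<close> is what makes \<open>f\<close> vanish when an argument
  is \<open>e\<close>.
\<close>

definition factor_set :: "('z, 'q, 'l) ext \<Rightarrow> ('q \<Rightarrow> 'l) \<Rightarrow> ('q \<times> 'q \<Rightarrow> 'z) \<Rightarrow> bool" where
  "factor_set = (\<lambda>(L, i, j) s f.
     f \<in> carrier (C2 Q Z) \<and>
     (\<forall>x\<in>carrier Q. s x \<in> carrier L \<and> j (s x) = x) \<and> s \<one>\<^bsub>Q\<^esub> = \<one>\<^bsub>L\<^esub> \<and>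
     (\<forall>x\<in>carrier Q. \<forall>y\<in>carrier Q. s x \<otimes>\<^bsub>L\<^esub> s y = s (x \<otimes>\<^bsub>Q\<^esub> y) \<otimes>\<^bsub>L\<^esub> i (f (x, y))))"

definition factor_class :: "('z, 'q, 'l) ext \<Rightarrow> ('q \<times> 'q \<Rightarrow> 'z) set" where
  "factor_class E = {f. \<exists>s. factor_set E s f}"

end

text \<open>
  Every normalized cochain \<open>h\<close> gives another section \<open>x \<mapsto> s(x) h(x)\<close>, whose factor set is cohomologous to
  the first one.
\<close>

lemma (in coordinatized) factor_set_of_coordinates:
  assumes h: "h \<in> carrier (C1 Q Z)"
  shows "factor_set (L, i, j) (\<lambda>x. p (x, h x)) (\<delta>1 Q Z act h \<otimes>\<^bsub>C2 Q Z\<^esub> f)"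
proof -
  let ?g = "\<delta>1 Q Z act h \<otimes>\<^bsub>C2 Q Z\<^esub> f"
  have g: "?g \<in> carrier (C2 Q Z)"
    using coboundary_mult_closed[OF h f] .
  have "p (x, h x) \<otimes>\<^bsub>L\<^esub> p (y, h y) = p (x \<otimes>\<^bsub>Q\<^esub> y, h (x \<otimes>\<^bsub>Q\<^esub> y)) \<otimes>\<^bsub>L\<^esub> i (?g (x, y))"
    if "x \<in> carrier Q" "y \<in> carrier Q" for x y
    using that coboundary_mult_eq_iff[OF h f C2_closed[OF g that] that]
    by (simp add: embed C2_closed[OF g] C1_closed[OF h])
  then show ?thesis
    using g by (simp add: factor_set_def one C1_closed[OF h] C1_normalized[OF h])
qed

locale loop_extension = loop_action Q Z act
  for Q :: "('q, 'k) monoid_scheme" and Z :: "('z, 'm) monoid_scheme" and act +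
  fixes L :: "'l monoid" and i :: "'z \<Rightarrow> 'l" and j :: "'l \<Rightarrow> 'q"
  assumes extension: "is_extension Z Q act (L, i, j)"
begin

sublocale L: loop L
  using extension by simp

lemmas L_simps [simp] = L.m_closed L.one_closed L.l_one L.r_one

lemma i_closed [simp]: "a \<in> carrier Z \<Longrightarrow> i a \<in> carrier L"
  and i_mult: "\<lbrakk>a \<in> carrier Z; b \<in> carrier Z\<rbrakk> \<Longrightarrow> i (a \<otimes>\<^bsub>Z\<^esub> b) = i a \<otimes>\<^bsub>L\<^esub> i b"
  and i_inj: "\<lbrakk>i a = i b; a \<in> carrier Z; b \<in> carrier Z\<rbrakk> \<Longrightarrow> a = b"
  using extension by (auto simp: mon_def hom_def inj_on_def)

lemma j_closed [simp]: "l \<in> carrier L \<Longrightarrow> j l \<in> carrier Q"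
  and j_mult [simp]: "\<lbrakk>l \<in> carrier L; m \<in> carrier L\<rbrakk> \<Longrightarrow> j (l \<otimes>\<^bsub>L\<^esub> m) = j l \<otimes>\<^bsub>Q\<^esub> j m"
  and j_surj: "carrier Q = j ` carrier L"
  using extension by (auto simp: epi_def hom_def)

lemma i_one [simp]: "i \<one>\<^bsub>Z\<^esub> = \<one>\<^bsub>L\<^esub>"
  using L.idempotent_is_one[of "i \<one>\<^bsub>Z\<^esub>"] i_mult[of "\<one>\<^bsub>Z\<^esub>" "\<one>\<^bsub>Z\<^esub>"] by simp

lemma j_one [simp]: "j \<one>\<^bsub>L\<^esub> = \<one>\<^bsub>Q\<^esub>"
  using Q.idempotent_is_one[of "j \<one>\<^bsub>L\<^esub>"] j_mult[of "\<one>\<^bsub>L\<^esub>" "\<one>\<^bsub>L\<^esub>"] by simp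

lemma kernel_iff: "l \<in> carrier L \<Longrightarrow> j l = \<one>\<^bsub>Q\<^esub> \<longleftrightarrow> l \<in> i ` carrier Z"
  using extension by (auto simp: kernel_def)

lemma j_i [simp]: "a \<in> carrier Z \<Longrightarrow> j (i a) = \<one>\<^bsub>Q\<^esub>"
  by (simp add: kernel_iff)

lemma assoc:
  assumes "u \<in> carrier L" "v \<in> carrier L" "w \<in> carrier L"
    and "u \<in> i ` carrier Z \<or> v \<in> i ` carrier Z \<or> w \<in> i ` carrier Z"
  shows "(u \<otimes>\<^bsub>L\<^esub> v) \<otimes>\<^bsub>L\<^esub> w = u \<otimes>\<^bsub>L\<^esub> (v \<otimes>\<^bsub>L\<^esub> w)"
  using extension assms by auto

lemma i_commute:
  "\<lbrakk>z \<in> carrier Z; l \<in> carrier L\<rbrakk> \<Longrightarrow> i z \<otimes>\<^bsub>L\<^esub> l = l \<otimes>\<^bsub>L\<^esub> i (act z (j l))"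
  using extension by auto

lemma fibre:
  assumes "l \<in> carrier L" "m \<in> carrier L" "j l = j m"
  obtains a where "a \<in> carrier Z" "m = l \<otimes>\<^bsub>L\<^esub> i a"
proof -
  obtain t where t: "t \<in> carrier L" "l \<otimes>\<^bsub>L\<^esub> t = m"
    using assms(1,2) by (rule L.l_solve)
  have "j l \<otimes>\<^bsub>Q\<^esub> j t = j l \<otimes>\<^bsub>Q\<^esub> \<one>\<^bsub>Q\<^esub>"
    using t assms by (metis Q.r_one j_closed j_mult)
  then have "j t = \<one>\<^bsub>Q\<^esub>"
    using t(1) assms(1) by (metis Q.l_cancel Q.one_closed j_closed)
  then show ?thesis
    using that t by (auto simp: kernel_iff)
qed

text \<open>
  The factor \<open>i a\<close> can be moved to the right end of the product. This uses both axioms on the kernel: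
  it may be rebracketed freely, and passing \<open>m\<close> turns \<open>a\<close> into \<open>act a (j m)\<close>.
\<close>

lemma translate_by_kernel:
  assumes l: "l \<in> carrier L" "m \<in> carrier L" and ab: "a \<in> carrier Z" "b \<in> carrier Z"
  shows "(l \<otimes>\<^bsub>L\<^esub> i a) \<otimes>\<^bsub>L\<^esub> (m \<otimes>\<^bsub>L\<^esub> i b) = (l \<otimes>\<^bsub>L\<^esub> m) \<otimes>\<^bsub>L\<^esub> i (act a (j m) \<otimes>\<^bsub>Z\<^esub> b)"
proof -
  have "(l \<otimes>\<^bsub>L\<^esub> i a) \<otimes>\<^bsub>L\<^esub> (m \<otimes>\<^bsub>L\<^esub> i b) = ((l \<otimes>\<^bsub>L\<^esub> i a) \<otimes>\<^bsub>L\<^esub> m) \<otimes>\<^bsub>L\<^esub> i b"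
    using assms by (simp add: assoc)
  also have "(l \<otimes>\<^bsub>L\<^esub> i a) \<otimes>\<^bsub>L\<^esub> m = l \<otimes>\<^bsub>L\<^esub> (m \<otimes>\<^bsub>L\<^esub> i (act a (j m)))"
    using assms by (simp add: assoc i_commute)
  also have "\<dots> = (l \<otimes>\<^bsub>L\<^esub> m) \<otimes>\<^bsub>L\<^esub> i (act a (j m))"
    using assms by (simp add: assoc)
  also have "\<dots> \<otimes>\<^bsub>L\<^esub> i b = (l \<otimes>\<^bsub>L\<^esub> m) \<otimes>\<^bsub>L\<^esub> i (act a (j m) \<otimes>\<^bsub>Z\<^esub> b)"
    using assms assoc[of "l \<otimes>\<^bsub>L\<^esub> m" "i (act a (j m))" "i b"] by (simp add: i_mult)
  finally show ?thesis .
qed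

lemma coordinates_of_factor_set:
  assumes "factor_set (L, i, j) s f"
  shows "coordinatized Q Z act f L i j (\<lambda>(x, a). s x \<otimes>\<^bsub>L\<^esub> i a)"
proof -
  have f: "f \<in> carrier (C2 Q Z)" and s_one: "s \<one>\<^bsub>Q\<^esub> = \<one>\<^bsub>L\<^esub>"
    and s [simp]: "\<And>x. x \<in> carrier Q \<Longrightarrow> s x \<in> carrier L" "\<And>x. x \<in> carrier Q \<Longrightarrow> j (s x) = x"
    and s_mult: "\<And>x y. \<lbrakk>x \<in> carrier Q; y \<in> carrier Q\<rbrakk> \<Longrightarrow>
      s x \<otimes>\<^bsub>L\<^esub> s y = s (x \<otimes>\<^bsub>Q\<^esub> y) \<otimes>\<^bsub>L\<^esub> i (f (x, y))"
    using assms by (auto simp: factor_set_def)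
  let ?p = "\<lambda>(x, a). s x \<otimes>\<^bsub>L\<^esub> i a"
  have "bij_betw ?p (carrier Q \<times> carrier Z) (carrier L)"
    unfolding bij_betw_def
  proof
    show "inj_on ?p (carrier Q \<times> carrier Z)"
    proof (rule inj_onI, clarify)
      fix x a y b
      assume xa: "x \<in> carrier Q" "a \<in> carrier Z" "y \<in> carrier Q" "b \<in> carrier Z"
        and eq: "s x \<otimes>\<^bsub>L\<^esub> i a = s y \<otimes>\<^bsub>L\<^esub> i b"
      have "x = y"
        using arg_cong[OF eq, of j] xa by simp
      moreover have "a = b"
        using eq xa unfolding \<open>x = y\<close> by (auto dest: i_inj)
      ultimately show "x = y \<and> a = b" ..
    qed
    show "?p ` (carrier Q \<times> carrier Z) = carrier L"
    proof (intro equalityI subsetI)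
      fix l assume l: "l \<in> carrier L"
      then obtain a where "a \<in> carrier Z" "l = s (j l) \<otimes>\<^bsub>L\<^esub> i a"
        using fibre[of "s (j l)" l] by auto
      then show "l \<in> ?p ` (carrier Q \<times> carrier Z)"
        using l by (intro image_eqI[of _ _ "(j l, a)"]) auto
    qed auto
  qed
  moreover have "(s x \<otimes>\<^bsub>L\<^esub> i a) \<otimes>\<^bsub>L\<^esub> (s y \<otimes>\<^bsub>L\<^esub> i b) =
      s (x \<otimes>\<^bsub>Q\<^esub> y) \<otimes>\<^bsub>L\<^esub> i (f (x, y) \<otimes>\<^bsub>Z\<^esub> act a y \<otimes>\<^bsub>Z\<^esub> b)"
    if "x \<in> carrier Q" "a \<in> carrier Z" "y \<in> carrier Q" "b \<in> carrier Z" for x a y b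
  proof -
    have fxy: "f (x, y) \<in> carrier Z"
      using that by (simp add: C2_closed[OF f])
    have "(s x \<otimes>\<^bsub>L\<^esub> i a) \<otimes>\<^bsub>L\<^esub> (s y \<otimes>\<^bsub>L\<^esub> i b) =
        (s (x \<otimes>\<^bsub>Q\<^esub> y) \<otimes>\<^bsub>L\<^esub> i (f (x, y))) \<otimes>\<^bsub>L\<^esub> i (act a y \<otimes>\<^bsub>Z\<^esub> b)"
      using that translate_by_kernel[of "s x" "s y" a b] by (simp add: s_mult)
    also have "\<dots> = s (x \<otimes>\<^bsub>Q\<^esub> y) \<otimes>\<^bsub>L\<^esub> i (f (x, y) \<otimes>\<^bsub>Z\<^esub> (act a y \<otimes>\<^bsub>Z\<^esub> b))"
      using that fxy assoc[of "s (x \<otimes>\<^bsub>Q\<^esub> y)" "i (f (x, y))" "i (act a y \<otimes>\<^bsub>Z\<^esub> b)"]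
      by (simp add: i_mult[of "f (x, y)" "act a y \<otimes>\<^bsub>Z\<^esub> b"])
    finally show ?thesis
      using that fxy by (simp add: Z.m_assoc)
  qed
  ultimately show ?thesis
    using f by unfold_locales (auto simp: coordinates_def s_one)
qed

lemma factor_class_nonempty: "factor_class (L, i, j) \<noteq> {}"
proof -
  have "\<exists>l\<in>carrier L. j l = x \<and> (x = \<one>\<^bsub>Q\<^esub> \<longrightarrow> l = \<one>\<^bsub>L\<^esub>)" if "x \<in> carrier Q" for x
    using that j_surj by (cases "x = \<one>\<^bsub>Q\<^esub>") auto
  then obtain s where s [simp]: "\<And>x. x \<in> carrier Q \<Longrightarrow> s x \<in> carrier L"
      "\<And>x. x \<in> carrier Q \<Longrightarrow> j (s x) = x" and s_one: "s \<one>\<^bsub>Q\<^esub> = \<one>\<^bsub>L\<^esub>"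
    by (metis Q.one_closed)
  have "\<exists>a\<in>carrier Z. s x \<otimes>\<^bsub>L\<^esub> s y = s (x \<otimes>\<^bsub>Q\<^esub> y) \<otimes>\<^bsub>L\<^esub> i a"
    if "x \<in> carrier Q" "y \<in> carrier Q" for x y
    using that fibre[of "s (x \<otimes>\<^bsub>Q\<^esub> y)" "s x \<otimes>\<^bsub>L\<^esub> s y"] by auto
  then obtain g where g: "\<And>x y. \<lbrakk>x \<in> carrier Q; y \<in> carrier Q\<rbrakk> \<Longrightarrow> g x y \<in> carrier Z"
      "\<And>x y. \<lbrakk>x \<in> carrier Q; y \<in> carrier Q\<rbrakk> \<Longrightarrow>
        s x \<otimes>\<^bsub>L\<^esub> s y = s (x \<otimes>\<^bsub>Q\<^esub> y) \<otimes>\<^bsub>L\<^esub> i (g x y)"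
    by metis
  have "g x \<one>\<^bsub>Q\<^esub> = \<one>\<^bsub>Z\<^esub>" "g \<one>\<^bsub>Q\<^esub> x = \<one>\<^bsub>Z\<^esub>" if x: "x \<in> carrier Q" for x
  proof -
    have *: "a = \<one>\<^bsub>Z\<^esub>" if "a \<in> carrier Z" "s x = s x \<otimes>\<^bsub>L\<^esub> i a" for a
      using L.l_cancel[of "s x" "i \<one>\<^bsub>Z\<^esub>" "i a"] i_inj[of "\<one>\<^bsub>Z\<^esub>" a] that x by simp
    show "g x \<one>\<^bsub>Q\<^esub> = \<one>\<^bsub>Z\<^esub>"
      using g[OF x Q.one_closed] x by (intro *) (auto simp: s_one)
    show "g \<one>\<^bsub>Q\<^esub> x = \<one>\<^bsub>Z\<^esub>"
      using g[OF Q.one_closed x] x by (intro *) (auto simp: s_one)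
  qed
  then have "(\<lambda>(x, y)\<in>carrier Q \<times> carrier Q. g x y) \<in> carrier (C2 Q Z)"
    using g(1) by (intro C2I) simp_all
  then have "factor_set (L, i, j) s (\<lambda>(x, y)\<in>carrier Q \<times> carrier Q. g x y)"
    using g(2) by (simp add: factor_set_def s_one)
  then show ?thesis
    by (auto simp: factor_class_def)
qed

text \<open>
  Two normalized sections differ in each fibre by an element of \<open>Z\<close>, hence by a cochain \<open>h\<close>; in the
  coordinates of the first section the second is \<open>x \<mapsto> (x, h x)\<close>.
\<close>

lemma factor_class_coset:
  assumes "f \<in> factor_class (L, i, j)"
  shows "factor_class (L, i, j) =
    (\<lambda>h. \<delta>1 Q Z act h \<otimes>\<^bsub>C2 Q Z\<^esub> f) ` carrier (C1 Q Z)"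
proof -
  obtain s where s: "factor_set (L, i, j) s f"
    using assms by (auto simp: factor_class_def)
  define p where "p = (\<lambda>(x, a). s x \<otimes>\<^bsub>L\<^esub> i a)"
  interpret p: coordinatized Q Z act f L i j p
    unfolding p_def using s by (rule coordinates_of_factor_set)
  show ?thesis
  proof (intro equalityI subsetI)
    fix g assume "g \<in> factor_class (L, i, j)"
    then obtain t where t: "factor_set (L, i, j) t g"
      by (auto simp: factor_class_def)
    have g: "g \<in> carrier (C2 Q Z)" and t_one: "t \<one>\<^bsub>Q\<^esub> = \<one>\<^bsub>L\<^esub>"
      and t_section: "\<And>x. x \<in> carrier Q \<Longrightarrow> t x \<in> carrier L" "\<And>x. x \<in> carrier Q \<Longrightarrow> j (t x) = x"
      and t_mult: "\<And>x y. \<lbrakk>x \<in> carrier Q; y \<in> carrier Q\<rbrakk> \<Longrightarrow>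
        t x \<otimes>\<^bsub>L\<^esub> t y = t (x \<otimes>\<^bsub>Q\<^esub> y) \<otimes>\<^bsub>L\<^esub> i (g (x, y))"
      using t by (auto simp: factor_set_def)
    have "\<exists>a\<in>carrier Z. t x = p (x, a)" if "x \<in> carrier Q" for x
    proof (rule p.carrier_cases[OF t_section(1)[OF that]])
      fix y a assume ya: "y \<in> carrier Q" "a \<in> carrier Z" "t x = p (y, a)"
      then have "x = y"
        using t_section(2)[OF that] p.proj by metis
      then show ?thesis
        using ya by blast
    qed
    then obtain k where k: "\<And>x. x \<in> carrier Q \<Longrightarrow> k x \<in> carrier Z"
        "\<And>x. x \<in> carrier Q \<Longrightarrow> t x = p (x, k x)"
      by metis
    define h where "h = restrict k (carrier Q)"
    have t_h: "t x = p (x, h x)" if "x \<in> carrier Q" for x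
      using that k(2) by (simp add: h_def)
    have h_closed: "h x \<in> carrier Z" if "x \<in> carrier Q" for x
      using that k(1) by (simp add: h_def)
    have "p (\<one>\<^bsub>Q\<^esub>, h \<one>\<^bsub>Q\<^esub>) = p (\<one>\<^bsub>Q\<^esub>, \<one>\<^bsub>Z\<^esub>)"
      using t_h[OF Q.one_closed] t_one p.one by metis
    then have "h \<one>\<^bsub>Q\<^esub> = \<one>\<^bsub>Z\<^esub>"
      using p.p_eq_iff h_closed Q.one_closed Z.one_closed by metis
    then have h: "h \<in> carrier (C1 Q Z)"
      using k(1) by (intro C1I) (simp_all add: h_def)
    have "g = \<delta>1 Q Z act h \<otimes>\<^bsub>C2 Q Z\<^esub> f"
    proof (rule C2_eqI[OF g coboundary_mult_closed[OF h p.f]])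
      fix x y assume xy: "x \<in> carrier Q" "y \<in> carrier Q"
      have "p (x, h x) \<otimes>\<^bsub>L\<^esub> p (y, h y) = p (x \<otimes>\<^bsub>Q\<^esub> y, h (x \<otimes>\<^bsub>Q\<^esub> y)) \<otimes>\<^bsub>L\<^esub> p (\<one>\<^bsub>Q\<^esub>, g (x, y))"
        using t_mult[OF xy] t_h xy g p.embed by (metis C2_closed Q.m_closed)
      then have "p (x \<otimes>\<^bsub>Q\<^esub> y, f (x, y) \<otimes>\<^bsub>Z\<^esub> act (h x) y \<otimes>\<^bsub>Z\<^esub> h y) =
          p (x \<otimes>\<^bsub>Q\<^esub> y, h (x \<otimes>\<^bsub>Q\<^esub> y) \<otimes>\<^bsub>Z\<^esub> g (x, y))"
        using xy by (simp add: C1_closed[OF h] C2_closed[OF g])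
      then have "f (x, y) \<otimes>\<^bsub>Z\<^esub> act (h x) y \<otimes>\<^bsub>Z\<^esub> h y = h (x \<otimes>\<^bsub>Q\<^esub> y) \<otimes>\<^bsub>Z\<^esub> g (x, y)"
        using xy by (subst (asm) p.p_eq_iff) (simp_all add: C1_closed[OF h] C2_closed[OF g])
      then show "g (x, y) = (\<delta>1 Q Z act h \<otimes>\<^bsub>C2 Q Z\<^esub> f) (x, y)"
        using coboundary_mult_eq_iff[OF h p.f C2_closed[OF g xy] xy] by simp
    qed
    then show "g \<in> (\<lambda>h. \<delta>1 Q Z act h \<otimes>\<^bsub>C2 Q Z\<^esub> f) ` carrier (C1 Q Z)"
      using h by blast
  next
    fix g assume "g \<in> (\<lambda>h. \<delta>1 Q Z act h \<otimes>\<^bsub>C2 Q Z\<^esub> f) ` carrier (C1 Q Z)"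
    then show "g \<in> factor_class (L, i, j)"
      using p.factor_set_of_coordinates by (auto simp: factor_class_def)
  qed
qed

end

section \<open>Equivalence of extensions\<close>

context loop_action
begin

text \<open>
  Both extensions have the same multiplication table in coordinates, so the map that keeps the
  coordinates is an equivalence.
\<close>

lemma common_factor_set_equivalent:
  assumes "is_extension Z Q act (L, iL, jL)" "is_extension Z Q act (M, iM, jM)"
    and "f \<in> factor_class (L, iL, jL)" "f \<in> factor_class (M, iM, jM)"
  shows "equivalent_ext Z (L, iL, jL) (M, iM, jM)"
proof -
  obtain s t where s: "factor_set (L, iL, jL) s f" and t: "factor_set (M, iM, jM) t f"
    using assms(3,4) by (auto simp: factor_class_def)
  have "loop_extension Q Z act L iL jL" "loop_extension Q Z act M iM jM"
    using assms(1,2) by unfold_locales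
  then obtain p q where "coordinatized Q Z act f L iL jL p" "coordinatized Q Z act f M iM jM q"
    using loop_extension.coordinates_of_factor_set s t by blast
  then interpret p: coordinatized Q Z act f L iL jL p + q: coordinatized Q Z act f M iM jM q .
  define \<phi> where "\<phi> m = p (inv_into (carrier Q \<times> carrier Z) q m)" for m
  have \<phi>: "\<phi> (q (x, a)) = p (x, a)" if "x \<in> carrier Q" "a \<in> carrier Z" for x a
    using q.bij that by (simp add: \<phi>_def bij_betw_def)
  have "\<phi> \<in> hom M L"
    by (auto simp: hom_def \<phi> elim!: q.carrier_cases)
  moreover have "\<phi> (iM z) = iL z" if "z \<in> carrier Z" for z
    using that by (simp add: p.embed q.embed \<phi>)
  moreover have "jL (\<phi> m) = jM m" if "m \<in> carrier M" for m
    using that by (auto simp: \<phi> elim!: q.carrier_cases)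
  ultimately show ?thesis
    by auto
qed

text \<open>
  An equivalence \<open>M \<rightarrow> L\<close> maps a section of \<open>M\<close> to a section of \<open>L\<close> with the same factor set.
\<close>

lemma equivalent_factor_class_subset:
  assumes "is_extension Z Q act (L, iL, jL)" "is_extension Z Q act (M, iM, jM)"
    and "equivalent_ext Z (L, iL, jL) (M, iM, jM)"
  shows "factor_class (M, iM, jM) \<subseteq> factor_class (L, iL, jL)"
proof
  interpret L: loop_extension Q Z act L iL jL
    using assms(1) by unfold_locales
  interpret M: loop_extension Q Z act M iM jM
    using assms(2) by unfold_locales
  obtain \<phi> where \<phi>: "\<phi> \<in> hom M L" and \<phi>_i: "\<And>z. z \<in> carrier Z \<Longrightarrow> \<phi> (iM z) = iL z"
    and \<phi>_j: "\<And>m. m \<in> carrier M \<Longrightarrow> jL (\<phi> m) = jM m"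
    using assms(3) by auto
  have \<phi>_one: "\<phi> \<one>\<^bsub>M\<^esub> = \<one>\<^bsub>L\<^esub>"
    using \<phi>_i[OF Z.one_closed] by simp
  fix f assume "f \<in> factor_class (M, iM, jM)"
  then obtain t where t: "factor_set (M, iM, jM) t f"
    by (auto simp: factor_class_def)
  have "\<phi> (t x) \<otimes>\<^bsub>L\<^esub> \<phi> (t y) = \<phi> (t (x \<otimes>\<^bsub>Q\<^esub> y)) \<otimes>\<^bsub>L\<^esub> iL (f (x, y))"
    if "x \<in> carrier Q" "y \<in> carrier Q" for x y
  proof -
    have closed: "t x \<in> carrier M" "t y \<in> carrier M" "t (x \<otimes>\<^bsub>Q\<^esub> y) \<in> carrier M"
        "f (x, y) \<in> carrier Z"
      using t that by (auto simp: factor_set_def C2_closed)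
    have "\<phi> (t x) \<otimes>\<^bsub>L\<^esub> \<phi> (t y) = \<phi> (t x \<otimes>\<^bsub>M\<^esub> t y)"
      using hom_mult[OF \<phi>] closed by simp
    also have "t x \<otimes>\<^bsub>M\<^esub> t y = t (x \<otimes>\<^bsub>Q\<^esub> y) \<otimes>\<^bsub>M\<^esub> iM (f (x, y))"
      using t that by (simp add: factor_set_def)
    also have "\<phi> \<dots> = \<phi> (t (x \<otimes>\<^bsub>Q\<^esub> y)) \<otimes>\<^bsub>L\<^esub> iL (f (x, y))"
      using hom_mult[OF \<phi>] closed by (simp add: \<phi>_i)
    finally show ?thesis .
  qed
  then have "factor_set (L, iL, jL) (\<phi> \<circ> t) f"
    using t \<phi>_one \<phi>_j \<phi> by (auto simp: factor_set_def hom_def)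
  then show "f \<in> factor_class (L, iL, jL)"
    by (auto simp: factor_class_def)
qed

text \<open>
  The relation is given by a homomorphism in one direction only, so its symmetry has to be
  obtained: one inclusion of factor classes suffices, since cosets that meet are equal.
\<close>

lemma equivalent_iff_factor_class_eq:
  assumes E: "is_extension Z Q act E" and E': "is_extension Z Q act E'"
  shows "equivalent_ext Z E E' \<longleftrightarrow> factor_class E = factor_class E'"
proof -
  obtain L iL jL where EL: "E = (L, iL, jL)"
    by (cases E)
  obtain M iM jM where EM: "E' = (M, iM, jM)"
    by (cases E')
  interpret L: loop_extension Q Z act L iL jL
    using E by unfold_locales (simp add: EL)
  interpret M: loop_extension Q Z act M iM jM
    using E' by unfold_locales (simp add: EM)
  obtain f where f: "f \<in> factor_class E'"
    using M.factor_class_nonempty by (auto simp: EM)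
  show ?thesis
  proof
    assume "equivalent_ext Z E E'"
    then have "factor_class E' \<subseteq> factor_class E"
      using equivalent_factor_class_subset[OF L.extension M.extension] by (simp add: EL EM)
    then show "factor_class E = factor_class E'"
      using L.factor_class_coset[of f] M.factor_class_coset[of f] f by (auto simp: EL EM)
  next
    assume "factor_class E = factor_class E'"
    then show "equivalent_ext Z E E'"
      using common_factor_set_equivalent[OF L.extension M.extension, of f] f by (simp add: EL EM)
  qed
qed

section \<open>Classification\<close>

text \<open>
  The twisted product for \<open>f\<close> is transported along an injection of \<open>Q \<times> Z\<close> into the given type.
\<close>

lemma extension_with_factor_set:
  assumes f: "f \<in> carrier (C2 Q Z)" and large: "carrier Q \<times> carrier Z \<lesssim> (UNIV :: 'l set)"
  obtains E :: "('z, 'q, 'l) ext" where "is_extension Z Q act E" "f \<in> factor_class E"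
proof -
  let ?QZ = "carrier Q \<times> carrier Z"
  obtain p :: "'q \<times> 'z \<Rightarrow> 'l" where p: "inj_on p ?QZ"
    using large by (auto simp: lepoll_def)
  let ?c = "inv_into ?QZ p"
  define mul where "mul = (\<lambda>(x, a) (y, b). p (x \<otimes>\<^bsub>Q\<^esub> y, f (x, y) \<otimes>\<^bsub>Z\<^esub> act a y \<otimes>\<^bsub>Z\<^esub> b))"
  define L where "L = \<lparr>carrier = p ` ?QZ, monoid.mult = (\<lambda>u v. mul (?c u) (?c v)), one = p (\<one>\<^bsub>Q\<^esub>, \<one>\<^bsub>Z\<^esub>)\<rparr>"
  let ?i = "\<lambda>a. p (\<one>\<^bsub>Q\<^esub>, a)" and ?j = "\<lambda>u. fst (?c u)"
  have "coordinates f (L, ?i, ?j) p"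
    using p by (simp add: coordinates_def L_def mul_def bij_betw_def)
  then interpret coordinatized Q Z act f L ?i ?j p
    using f by unfold_locales
  \<comment> \<open>The section \<open>x \<mapsto> (x, 0)\<close> itself, seen as the change of section by the zero cochain.\<close>
  have zero: "(\<lambda>_\<in>carrier Q. \<one>\<^bsub>Z\<^esub>) \<in> carrier (C1 Q Z)" (is "?h \<in> _")
    by (intro C1I) simp_all
  have "\<delta>1 Q Z act ?h \<otimes>\<^bsub>C2 Q Z\<^esub> f = f"
    using coboundary_mult_closed[OF zero f] f
    by (rule C2_eqI) (simp add: C2_mult \<delta>1_def)
  then have "f \<in> factor_class (L, ?i, ?j)"
    using factor_set_of_coordinates[OF zero] by (auto simp: factor_class_def)
  then show ?thesis
    using extension that by blast
qed

lemma factor_class_in_kernel_iff: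
  assumes "one_nested_bracketing n P" "satisfies_identity Q n \<rho> P"
    and E: "is_extension Z Q act E" and f: "f \<in> factor_class E"
  shows "satisfies_identity (fst E) n \<rho> P \<longleftrightarrow>
    f \<in> kernel (C2 Q Z) (C3 Q Z) (\<delta>\<rho> Q Z act n \<rho> P)"
proof -
  obtain L i j where EL: "E = (L, i, j)"
    by (cases E)
  interpret loop_extension Q Z act L i j
    using E by unfold_locales (simp add: EL)
  obtain s where "factor_set (L, i, j) s f"
    using f by (auto simp: factor_class_def EL)
  then interpret coordinatized Q Z act f L i j "\<lambda>(x, a). s x \<otimes>\<^bsub>L\<^esub> i a"
    by (rule coordinates_of_factor_set)
  show ?thesis
    using identity_iff_cocycle[OF assms(1,2)] by (simp add: EL)
qed

lemma factor_class_image: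
  assumes "one_nested_bracketing n P" "satisfies_identity Q n \<rho> P"
    and large: "carrier Q \<times> carrier Z \<lesssim> (UNIV :: 'l set)"
  shows "factor_class ` (extensions_satisfying Q Z act n \<rho> P :: ('z, 'q, 'l) ext set) =
    carrier (H2 Q Z act n \<rho> P)"
proof -
  let ?coset = "\<lambda>f. (\<lambda>h. \<delta>1 Q Z act h \<otimes>\<^bsub>C2 Q Z\<^esub> f) ` carrier (C1 Q Z)"
  let ?ker = "kernel (C2 Q Z) (C3 Q Z) (\<delta>\<rho> Q Z act n \<rho> P)"
  have coset: "factor_class E = ?coset f"
    if "is_extension Z Q act E" "f \<in> factor_class E" for E :: "('z, 'q, 'l) ext" and f
  proof -
    obtain L i j where EL: "E = (L, i, j)"
      by (cases E)
    interpret loop_extension Q Z act L i j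
      using that by unfold_locales (simp add: EL)
    show ?thesis
      using factor_class_coset[of f] that by (simp add: EL)
  qed
  have H2: "carrier (H2 Q Z act n \<rho> P) = ?coset ` ?ker"
    by (auto simp: H2_def FactGroup_def RCOSETS_def r_coset_def)
  show ?thesis
    unfolding H2
  proof (intro equalityI subsetI)
    fix K assume "K \<in> factor_class ` (extensions_satisfying Q Z act n \<rho> P :: ('z, 'q, 'l) ext set)"
    then obtain E :: "('z, 'q, 'l) ext" where K: "K = factor_class E"
      and E: "is_extension Z Q act E" "satisfies_identity (fst E) n \<rho> P"
      by (auto simp: extensions_satisfying_def)
    obtain L i j where EL: "E = (L, i, j)"
      by (cases E)
    interpret loop_extension Q Z act L i j
      using E by unfold_locales (simp add: EL)
    obtain f where f: "f \<in> factor_class E"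
      using factor_class_nonempty by (auto simp: EL)
    show "K \<in> ?coset ` ?ker"
      using factor_class_in_kernel_iff[OF assms(1,2) E(1) f] coset[OF E(1) f] E(2) K by blast
  next
    fix K assume "K \<in> ?coset ` ?ker"
    then obtain f where f: "f \<in> ?ker" and K: "K = ?coset f"
      by blast
    have "f \<in> carrier (C2 Q Z)"
      using f by (simp add: kernel_def)
    then obtain E :: "('z, 'q, 'l) ext" where E: "is_extension Z Q act E" "f \<in> factor_class E"
      using large by (rule extension_with_factor_set)
    then show "K \<in> factor_class ` (extensions_satisfying Q Z act n \<rho> P :: ('z, 'q, 'l) ext set)"
      using factor_class_in_kernel_iff[OF assms(1,2) E] coset[OF E] f K
      by (auto simp: extensions_satisfying_def)
  qed
qed

end

text \<open>
  The quotient of a set by the kernel relation of a map \<open>k\<close> is in bijection with the image of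
  \<open>k\<close>. Since \<open>k\<close> is constant on each class, \<open>the_elem\<close> reads off its value without choosing a
  representative.
\<close>

lemma bij_betw_quotient_by_kernel_relation:
  assumes R: "\<And>x y. (x, y) \<in> R \<longleftrightarrow> x \<in> A \<and> y \<in> A \<and> k x = k y"
  shows "bij_betw (\<lambda>C. the_elem (k ` C)) (A // R) (k ` A)"
proof -
  have fibre: "the_elem (k ` (R `` {x})) = k x" if "x \<in> A" for x
  proof -
    have "k ` (R `` {x}) = {k x}"
      using that R by (auto simp: image_iff)
    then show ?thesis
      by simp
  qed
  have "inj_on (\<lambda>C. the_elem (k ` C)) (A // R)"
    by (rule inj_onI) (auto simp: quotient_def fibre R)
  moreover have "(\<lambda>C. the_elem (k ` C)) ` (A // R) = k ` A"
    by (auto simp: quotient_def image_iff fibre)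
  ultimately show ?thesis
    by (simp add: bij_betw_def)
qed

theorem theorem1:
  fixes n :: nat and \<rho> :: "nat \<Rightarrow> nat" and P :: bracketing
    and Q :: "('q, 'k) monoid_scheme" and Z :: "('z, 'm) monoid_scheme"
    and act :: "'z \<Rightarrow> 'q \<Rightarrow> 'z"
  assumes "n \<ge> 4"
    and "\<rho> ` {1..n} = {1, 2, 3}"
    and "one_nested_bracketing n P"
    and "last_step_right P"
    and "loop Q"
    and "satisfies_identity Q n \<rho> P"
    and "comm_group Z"
    and "is_action Z Q act"
    and large: "carrier Q \<times> carrier Z \<lesssim> (UNIV :: 'l set)"
  shows "\<exists>\<Phi> :: ('z, 'q, 'l) ext set \<Rightarrow> ('q \<times> 'q \<Rightarrow> 'z) set.
           bij_betw \<Phi>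
             (extensions_satisfying Q Z act n \<rho> P // ext_equivalence Q Z act n \<rho> P)
             (carrier (H2 Q Z act n \<rho> P))"
proof -
  interpret loop_action Q Z act
    using assms(5,7,8) by (simp add: loop_action_def loop_action_axioms_def)
  have "(E, E') \<in> ext_equivalence Q Z act n \<rho> P \<longleftrightarrow>
      E \<in> extensions_satisfying Q Z act n \<rho> P \<and> E' \<in> extensions_satisfying Q Z act n \<rho> P \<and>
      factor_class E = factor_class E'" for E E' :: "('z, 'q, 'l) ext"
    using equivalent_iff_factor_class_eq[of E E']
    by (auto simp: ext_equivalence_def extensions_satisfying_def)
  then have "bij_betw (\<lambda>C. the_elem (factor_class ` C))
      ((extensions_satisfying Q Z act n \<rho> P :: ('z, 'q, 'l) ext set) //
        ext_equivalence Q Z act n \<rho> P)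
      (factor_class ` (extensions_satisfying Q Z act n \<rho> P :: ('z, 'q, 'l) ext set))"
    by (rule bij_betw_quotient_by_kernel_relation)
  then show ?thesis
    unfolding factor_class_image[OF assms(3,6) large] by blast
qed

end
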